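(* Let $\theta\in(0,1]$ and let $\mathbb{T}\colon\mathcal{H}\to\mathcal{H}$ be $\theta$-averaged with respect to the norm $\|\cdot\|$. Let $\mathcal{I}^0,\mathcal{I}^1,\ldots$ be IID random vectors in $[0,1]^m$ whose common distribution satisfies $\mathbb{E}[\mathcal{I}]=\alpha\mathbf{1}$ with some $\alpha\in(0,1]$. Let $x^0\in\mathcal{H}$ and $x^{k+1}=\mathbb{T}_{\mathcal{I}^k}x^k$ for $k=0,1,2,\dots$. Let $\mathbf{v}$ be the infimal displacement vector of $\mathbb{T}$. Then $\frac{x^k}{k}\to-\alpha\mathbf{v}$ in $L^2$ as $k\to\infty$, i.e. $$\lim_{k\to\infty}\mathbb{E}\left[\left\|\frac{x^k}{k}+\alpha\mathbf{v}\right\|^2\right]=0 .$$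
   Context: $\mathcal{H}=\mathcal{H}_1\oplus\cdots\oplus\mathcal{H}_m$ is a direct sum of real Hilbert spaces, with $\langle x,y\rangle=\sum_{i=1}^m\langle x_i,y_i\rangle_i$ and $\|x\|^2=\sum_{i=1}^m\|x_i\|_i^2$, where $x_i\in\mathcal{H}_i$ is the $i$th block of $x$. $\mathrm{Id}$ is the identity operator. An operator $\mathbb{T}$ is $\theta$-averaged with respect to a norm, $\theta\in(0,1]$, if $\mathbb{T}=(1-\theta)\mathrm{Id}+\theta\mathbb{C}$ for some operator $\mathbb{C}$ that is non-expansive (1-Lipschitz) in that norm; for $\theta=1$ this just means $\mathbb{T}$ is non-expansive. Put $\mathbb{S}=\theta^{-1}(\mathrm{Id}-\mathbb{T})$ and $\mathbb{S}_ix=(0,\dots,0,(\mathbb{S}x)_i,0,\dots,0)$ (only the $i$th block kept). For a selection vector $\mathcal{I}=(\mathcal{I}_1,\dots,\mathcal{I}_m)\in[0,1]^m$ put $\mathbb{S}_{\mathcal{I}}=\sum_{i=1}^m\mathcal{I}_i\mathbb{S}_i$ and $\mathbb{T}_{\mathcal{I}}=\mathrm{Id}-\theta\mathbb{S}_{\mathcal{I}}$. $\mathbf{1}\in\mathbb{R}^m$ is the all-ones vector. The infimal displacement vector $\mathbf{v}$ of $\mathbb{T}$ is the unique minimum-norm element of the nonempty closed convex set $\overline{\mathrm{range}(\mathrm{Id}-\mathbb{T})}$. The starting point $x^0$ is deterministic. *)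

theory Defs
  imports "HOL-Probability.Independent_Family"
begin

text \<open>
  The real Hilbert spaces \<open>H i\<close> are complete linear subspaces of a common real inner product
  space \<open>'b\<close>. This is no restriction: any finite family of Hilbert spaces embeds isometrically
  into one such space, for instance into its orthogonal direct sum. The inner product and norm
  of the type \<open>'b^'m\<close> are those of the direct sum, \<open>inner x y = (\<Sum>i. inner (x $ i) (y $ i))\<close>.
  Operators on the direct sum matter only on the carrier \<open>direct_sum H\<close>.
\<close>

definition hilbert_subspace :: "'b::real_inner set \<Rightarrow> bool" where
  "hilbert_subspace V \<longleftrightarrow> subspace V \<and> complete V"

definition direct_sum :: "('m::finite \<Rightarrow> 'b::real_inner set) \<Rightarrow> ('b^'m) set" where
  "direct_sum H = {x. \<forall>i. x $ i \<in> H i}"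

definition averaged_on :: "real \<Rightarrow> 'a::real_normed_vector set \<Rightarrow> ('a \<Rightarrow> 'a) \<Rightarrow> bool" where
  "averaged_on \<theta> X T \<longleftrightarrow>
     (\<exists>C. C \<in> X \<rightarrow> X \<and> 1-lipschitz_on X C \<and> (\<forall>x\<in>X. T x = (1 - \<theta>) *\<^sub>R x + \<theta> *\<^sub>R C x))"

definition S_op :: "real \<Rightarrow> ('a::real_vector \<Rightarrow> 'a) \<Rightarrow> 'a \<Rightarrow> 'a" where
  "S_op \<theta> T x = inverse \<theta> *\<^sub>R (x - T x)"

definition S_block ::
  "real \<Rightarrow> ('b::real_inner^'m::finite \<Rightarrow> 'b^'m) \<Rightarrow> 'm \<Rightarrow> 'b^'m \<Rightarrow> 'b^'m" where
  "S_block \<theta> T i x = axis i (S_op \<theta> T x $ i)"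

definition S_sel ::
  "real \<Rightarrow> ('b::real_inner^'m::finite \<Rightarrow> 'b^'m) \<Rightarrow> real^'m \<Rightarrow> 'b^'m \<Rightarrow> 'b^'m" where
  "S_sel \<theta> T p x = (\<Sum>i\<in>UNIV. p $ i *\<^sub>R S_block \<theta> T i x)"

definition T_sel ::
  "real \<Rightarrow> ('b::real_inner^'m::finite \<Rightarrow> 'b^'m) \<Rightarrow> real^'m \<Rightarrow> 'b^'m \<Rightarrow> 'b^'m" where
  "T_sel \<theta> T p x = x - \<theta> *\<^sub>R S_sel \<theta> T p x"

text \<open>
  The closure is taken in the ambient type; for a complete, hence closed, carrier \<open>X\<close> that
  \<open>T\<close> maps into itself it agrees with the closure in \<open>X\<close>.
\<close>

definition infimal_displacement ::
  "'a::real_normed_vector set \<Rightarrow> ('a \<Rightarrow> 'a) \<Rightarrow> 'a" where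
  "infimal_displacement X T =
     (THE v. is_arg_min norm (\<lambda>w. w \<in> closure ((\<lambda>x. x - T x) ` X)) v)"

end

theory Submission
  imports Defs
begin

text \<open>
  Put \<open>A = Id - T\<close>. Averagedness makes \<open>T\<close> non-expansive, so \<open>A\<close> is cocoercive:
  \<open>\<parallel>A x - A y\<parallel>\<^sup>2 \<le> 2 \<langle>A x - A y, x - y\<rangle>\<close>. One step of the iteration removes from the block \<open>x\<^sub>i\<close>
  the portion \<open>\<I>\<^sub>i (A x)\<^sub>i\<close>.

  The infimal displacement vector \<open>v\<close> is in the closure of the range of \<open>A\<close> and satisfies
  \<open>\<langle>v, A y - v\<rangle> \<ge> 0\<close> for every \<open>y\<close> (\<open>infimal_displacement_variational\<close>). Convexity of that closure
  would give this by projection, but the resolvent gives it directly: the solutions \<open>x\<^sub>\<lambda>\<close> of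
  \<open>\<lambda> x + A x = 0\<close> have displacements \<open>A x\<^sub>\<lambda>\<close> that form a Cauchy net as \<open>\<lambda>\<close> tends to \<open>0\<close>, and
  monotonicity of \<open>A\<close> yields the inequality for their limit.

  Now choose \<open>z\<close> with \<open>\<parallel>A z - v\<parallel> \<le> \<epsilon>\<close> and follow the deviation
  \<open>r\<^sub>k = x\<^sup>k - z + (k \<alpha> + 1) v\<close> of the iterate from a point that starts near \<open>z\<close> and drifts with
  velocity \<open>-\<alpha> v\<close>. Because \<open>\<I>\<^sub>i\<^sup>2 \<le> \<I>\<^sub>i\<close>, the squared norm of \<open>r\<^bsub>k+1\<^esub>\<close> is bounded by an expression
  that is affine in the selection vector, and the selection vector is independent of \<open>x\<^sup>k\<close>; its
  mean may therefore be inserted. The quadratic terms that remain are absorbed by cocoercivity,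
  the terms linear in \<open>A x\<^sup>k - v\<close> have a favourable sign by the variational inequality, and
  \<open>E \<parallel>r\<^bsub>k+1\<^esub>\<parallel>\<^sup>2 \<le> E \<parallel>r\<^sub>k\<parallel>\<^sup>2 + 6 \<epsilon> E \<parallel>x\<^sup>k - z\<parallel> + \<epsilon>\<^sup>2 + \<parallel>v\<parallel>\<^sup>2\<close> remains (\<open>mean_update_bound\<close>,
  \<open>second_moment_step\<close>). Since \<open>\<parallel>x\<^sup>k - z\<parallel>\<close> exceeds \<open>\<parallel>r\<^sub>k\<parallel>\<close> by at most \<open>(k + 1) \<parallel>v\<parallel>\<close>, this recursion
  preserves a bound \<open>E \<parallel>r\<^sub>k\<parallel>\<^sup>2 \<le> (c k + d)\<^sup>2\<close> whose slope \<open>c\<close> is as small as desired when \<open>\<epsilon>\<close> is small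
  (\<open>second_moment_growth\<close>). Dividing by \<open>k\<^sup>2\<close> bounds the limit superior of the mean squared error
  by \<open>2 c\<^sup>2\<close> for every such \<open>c\<close>.
\<close>

section \<open>Displacements of non-expansive maps\<close>

text \<open>
  Writing \<open>T x - T y\<close> as \<open>(x - y)\<close> minus the difference \<open>d\<close> of the displacements and expanding
  \<open>\<parallel>T x - T y\<parallel>\<^sup>2 \<le> \<parallel>x - y\<parallel>\<^sup>2\<close> leaves \<open>\<parallel>d\<parallel>\<^sup>2\<close> and the inner product of \<open>d\<close> with \<open>x - y\<close>.
\<close>

lemma displacement_cocoercive:
  fixes T :: "'a::real_inner \<Rightarrow> 'a"
  assumes "1-lipschitz_on X T" and "x \<in> X" and "y \<in> X"
  shows "(norm ((x - T x) - (y - T y)))\<^sup>2 \<le> 2 * (((x - T x) - (y - T y)) \<bullet> (x - y))"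
proof -
  have "norm (T x - T y) \<le> norm (x - y)"
    using lipschitz_onD[OF assms] by (simp add: dist_norm)
  then have "(norm (T x - T y))\<^sup>2 \<le> (norm (x - y))\<^sup>2"
    by (simp add: power_mono)
  then show ?thesis
    by (simp add: power2_norm_eq_inner algebra_simps inner_commute)
qed

lemma averaged_imp_nonexpansive:
  assumes "averaged_on \<theta> X T" and "0 < \<theta>" and "\<theta> \<le> 1"
  shows "1-lipschitz_on X T"
proof (rule lipschitz_onI)
  from assms obtain C where lip: "1-lipschitz_on X C"
    and T: "\<And>x. x \<in> X \<Longrightarrow> T x = (1 - \<theta>) *\<^sub>R x + \<theta> *\<^sub>R C x"
    by (auto simp: averaged_on_def)
  fix x y assume xy: "x \<in> X" "y \<in> X"
  have "T x - T y = (1 - \<theta>) *\<^sub>R (x - y) + \<theta> *\<^sub>R (C x - C y)"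
    by (simp add: T xy algebra_simps)
  then have "norm (T x - T y) \<le> (1 - \<theta>) * norm (x - y) + \<theta> * norm (C x - C y)"
    using norm_triangle_ineq[of "(1 - \<theta>) *\<^sub>R (x - y)" "\<theta> *\<^sub>R (C x - C y)"] assms by simp
  also have "\<dots> \<le> (1 - \<theta>) * norm (x - y) + \<theta> * norm (x - y)"
    using lipschitz_onD[OF lip xy] assms by (intro add_left_mono mult_left_mono) (auto simp: dist_norm)
  finally show "dist (T x) (T y) \<le> 1 * dist x y"
    by (simp add: dist_norm algebra_simps)
qed simp

section \<open>The infimal displacement vector\<close>

text \<open>
  The equation says that \<open>x\<close> is a fixed point of \<open>x \<mapsto> T x / (1 + l)\<close>, which is a contraction.
  The point \<open>x\<close> is the resolvent of \<open>(Id - T) / l\<close> at the origin.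
\<close>

lemma resolvent_point_exists:
  fixes T :: "'a::real_inner \<Rightarrow> 'a"
  assumes X: "subspace X" "complete X" and T: "T \<in> X \<rightarrow> X" "1-lipschitz_on X T" and "0 < l"
  shows "\<exists>x\<in>X. x - T x = - (l *\<^sub>R x)"
proof -
  let ?c = "inverse (1 + l)"
  have c: "0 \<le> ?c" "?c < 1"
    using \<open>0 < l\<close> by (auto simp: field_simps)
  have "X \<noteq> {}"
    using subspace_0[OF X(1)] by blast
  moreover have "(\<lambda>x. ?c *\<^sub>R T x) ` X \<subseteq> X"
    using T X by (auto intro!: subspace_scale)
  moreover have "dist (?c *\<^sub>R T x) (?c *\<^sub>R T y) \<le> ?c * dist x y" if "x \<in> X" "y \<in> X" for x y
    using lipschitz_onD[OF T(2) that] c \<open>0 < l\<close>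
    by (simp add: dist_norm scaleR_diff_right[symmetric] mult_left_mono del: scaleR_diff_right)
  ultimately obtain x where x: "x \<in> X" "?c *\<^sub>R T x = x"
    using Banach_fix[OF X(2) _ c, of "\<lambda>x. ?c *\<^sub>R T x"] by blast
  have "T x = (1 + l) *\<^sub>R (?c *\<^sub>R T x)"
    using \<open>0 < l\<close> by simp
  with x have "T x = (1 + l) *\<^sub>R x" by simp
  with x(1) show ?thesis
    by (intro bexI[of _ x]) (auto simp: algebra_simps)
qed

text \<open>
  This makes displacements of resolvent points Cauchy as the parameter decreases: their squared
  norms decrease as well, hence converge, and control the distances. Monotonicity, multiplied by
  \<open>l m\<close>, turns into an inequality between the displacements \<open>p\<close> and \<open>q\<close> alone, because \<open>l x = - p\<close>
  and \<open>m y = - q\<close>; it forces \<open>\<parallel>p\<parallel>\<^sup>2 \<le> \<langle>p, q\<rangle>\<close>.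
\<close>

lemma resolvent_displacement_diff:
  fixes T :: "'a::real_inner \<Rightarrow> 'a"
  assumes lip: "1-lipschitz_on X T" and X: "x \<in> X" "y \<in> X"
    and l: "0 < l" "l \<le> m"
    and x: "x - T x = - (l *\<^sub>R x)" and y: "y - T y = - (m *\<^sub>R y)"
  shows "(norm ((x - T x) - (y - T y)))\<^sup>2 \<le> (norm (y - T y))\<^sup>2 - (norm (x - T x))\<^sup>2"
proof -
  define p q where "p = x - T x" and "q = y - T y"
  have "0 \<le> (p - q) \<bullet> (x - y)"
    using displacement_cocoercive[OF lip X] zero_le_power2[of "norm (p - q)"]
    unfolding p_def q_def by linarith
  then have "0 \<le> l * m * ((p - q) \<bullet> (x - y))"
    using l by simp
  also have "\<dots> = (p - q) \<bullet> (m *\<^sub>R (l *\<^sub>R x) - l *\<^sub>R (m *\<^sub>R y))"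
    by (simp add: inner_diff_right algebra_simps)
  also have "\<dots> = (p - q) \<bullet> (l *\<^sub>R q - m *\<^sub>R p)"
    using x y by (simp add: p_def[symmetric] q_def[symmetric])
  finally have *: "m * ((p - q) \<bullet> p) \<le> l * ((p - q) \<bullet> q)"
    by (simp add: inner_diff_right)
  have **: "(p - q) \<bullet> p - (p - q) \<bullet> q = (norm (p - q))\<^sup>2"
    by (simp add: power2_norm_eq_inner inner_diff_right)
  \<comment> \<open>If \<open>(p - q) \<bullet> p\<close> were positive, \<open>l \<le> m\<close> would turn the weighted inequality into an unweighted
    one, whose only solution is \<open>p = q\<close>.\<close>
  have "(p - q) \<bullet> p \<le> 0"
  proof (rule ccontr)
    assume "\<not> ?thesis"
    then have "l * ((p - q) \<bullet> p) \<le> m * ((p - q) \<bullet> p)"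
      using l by (intro mult_right_mono) auto
    with * have "l * ((p - q) \<bullet> p) \<le> l * ((p - q) \<bullet> q)" by linarith
    then have "(p - q) \<bullet> p \<le> (p - q) \<bullet> q" using l by simp
    with ** have "(norm (p - q))\<^sup>2 \<le> 0" by linarith
    then have "p - q = 0" by simp
    with \<open>\<not> ?thesis\<close> show False by simp
  qed
  then show ?thesis
    unfolding p_def[symmetric] q_def[symmetric]
    by (simp add: power2_norm_eq_inner inner_diff_left inner_diff_right inner_commute)
qed

text \<open>
  The vector \<open>v\<close> is the limit of the displacements of the resolvent points for the parameters
  \<open>1 / (n + 1)\<close>. Monotonicity between \<open>y\<close> and these points passes to the limit: the points may
  escape to infinity, but their products with the parameter are minus their displacements.
\<close>

lemma minimal_displacement_exists:
  fixes T :: "'a::real_inner \<Rightarrow> 'a"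
  assumes X: "subspace X" "complete X" and T: "T \<in> X \<rightarrow> X" "1-lipschitz_on X T"
  shows "\<exists>v. v \<in> closure ((\<lambda>x. x - T x) ` X) \<and> (\<forall>y\<in>X. 0 \<le> v \<bullet> ((y - T y) - v))"
proof -
  define l where "l n = inverse (real (Suc n))" for n
  have l: "0 < l n" for n by (simp add: l_def)
  have l0: "l \<longlonglongrightarrow> 0"
    unfolding l_def by (rule LIMSEQ_inverse_real_of_nat)
  have "\<forall>n. \<exists>x\<in>X. x - T x = - (l n *\<^sub>R x)"
    using resolvent_point_exists[OF X T l] by blast
  then obtain r where r: "\<And>n. r n \<in> X" "\<And>n. r n - T (r n) = - (l n *\<^sub>R r n)"
    by metis
  define p where "p n = r n - T (r n)" for n
  have pX: "p n \<in> X" for n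
    unfolding p_def using X(1) T(1) r(1) by (auto intro!: subspace_diff)
  have step: "(norm (p n - p m))\<^sup>2 \<le> (norm (p m))\<^sup>2 - (norm (p n))\<^sup>2" if "m \<le> n" for m n
    unfolding p_def using that
    by (intro resolvent_displacement_diff[OF T(2) r(1) r(1) l _ r(2) r(2)]) (simp add: l_def)
  have "decseq (\<lambda>n. (norm (p n))\<^sup>2)"
    unfolding decseq_def
  proof (intro allI impI)
    fix m n :: nat assume "m \<le> n"
    from step[OF this] show "(norm (p n))\<^sup>2 \<le> (norm (p m))\<^sup>2"
      using zero_le_power2[of "norm (p n - p m)"] by linarith
  qed
  then obtain L where "(\<lambda>n. (norm (p n))\<^sup>2) \<longlonglongrightarrow> L"
    using decseq_convergent[of "\<lambda>n. (norm (p n))\<^sup>2" 0] by auto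
  then have Cau: "Cauchy (\<lambda>n. (norm (p n))\<^sup>2)"
    by (rule LIMSEQ_imp_Cauchy)
  have "Cauchy p"
  proof (rule metric_CauchyI)
    fix e :: real assume "0 < e"
    then obtain N where N: "\<And>m n. m \<ge> N \<Longrightarrow> n \<ge> N \<Longrightarrow> dist ((norm (p m))\<^sup>2) ((norm (p n))\<^sup>2) < e\<^sup>2"
      using metric_CauchyD[OF Cau, of "e\<^sup>2"] by auto
    have "dist (p n) (p m) < e" if "m \<ge> N" "m \<le> n" for m n
    proof -
      have "(norm (p n - p m))\<^sup>2 < e\<^sup>2"
        using step[OF that(2)] N[of m n] that by (auto simp: dist_real_def)
      then show ?thesis
        using \<open>0 < e\<close> by (simp add: dist_norm power2_less_imp_less)
    qed
    then show "\<exists>M. \<forall>m\<ge>M. \<forall>n\<ge>M. dist (p m) (p n) < e"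
      by (metis dist_commute nle_le)
  qed
  then obtain v where v: "p \<longlonglongrightarrow> v"
    using X(2) pX unfolding complete_def by blast
  have "v \<in> closure ((\<lambda>x. x - T x) ` X)"
    unfolding closure_sequential using v r(1) by (auto intro!: exI[of _ p] simp: p_def)
  moreover have "0 \<le> v \<bullet> ((y - T y) - v)" if "y \<in> X" for y
  proof -
    have "0 \<le> (p n - (y - T y)) \<bullet> (- p n - l n *\<^sub>R y)" for n
    proof -
      have "0 \<le> (p n - (y - T y)) \<bullet> (r n - y)"
        using displacement_cocoercive[OF T(2) r(1) that, of n]
          zero_le_power2[of "norm (p n - (y - T y))"]
        unfolding p_def by linarith
      then have "0 \<le> l n * ((p n - (y - T y)) \<bullet> (r n - y))"
        using l[of n] by simp
      also have "\<dots> = (p n - (y - T y)) \<bullet> (l n *\<^sub>R r n - l n *\<^sub>R y)"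
        by (simp add: inner_diff_right right_diff_distrib)
      also have "l n *\<^sub>R r n = - p n"
        using r(2)[of n] by (simp add: p_def)
      finally show ?thesis .
    qed
    moreover have "(\<lambda>n. (p n - (y - T y)) \<bullet> (- p n - l n *\<^sub>R y))
        \<longlonglongrightarrow> (v - (y - T y)) \<bullet> (- v - 0 *\<^sub>R y)"
      by (intro tendsto_intros v l0)
    ultimately have "0 \<le> (v - (y - T y)) \<bullet> (- v - 0 *\<^sub>R y)"
      by (intro LIMSEQ_le_const) auto
    then show ?thesis
      by (simp add: inner_diff_left inner_diff_right inner_commute)
  qed
  ultimately show ?thesis by blast
qed

text \<open>
  The variational inequality gives \<open>\<parallel>w - v\<parallel>\<^sup>2 \<le> \<parallel>w\<parallel>\<^sup>2 - \<parallel>v\<parallel>\<^sup>2\<close> on the closure of the range. Thus \<open>v\<close> has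
  minimal norm, and any other minimizer has distance \<open>0\<close> from it.
\<close>

lemma infimal_displacement_variational:
  fixes T :: "'a::real_inner \<Rightarrow> 'a"
  assumes X: "subspace X" "complete X" and T: "T \<in> X \<rightarrow> X" "1-lipschitz_on X T"
  shows "infimal_displacement X T \<in> closure ((\<lambda>x. x - T x) ` X)"
    and "y \<in> X \<Longrightarrow> 0 \<le> infimal_displacement X T \<bullet> ((y - T y) - infimal_displacement X T)"
proof -
  let ?R = "(\<lambda>x. x - T x) ` X"
  obtain v where v: "v \<in> closure ?R" "\<And>y. y \<in> X \<Longrightarrow> 0 \<le> v \<bullet> ((y - T y) - v)"
    using minimal_displacement_exists[OF X T] by blast
  have var: "0 \<le> v \<bullet> (w - v)" if "w \<in> closure ?R" for w
  proof -
    obtain f where f: "\<And>n. f n \<in> ?R" "f \<longlonglongrightarrow> w"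
      using \<open>w \<in> closure ?R\<close> unfolding closure_sequential by blast
    have "(\<lambda>n. v \<bullet> (f n - v)) \<longlonglongrightarrow> v \<bullet> (w - v)"
      by (intro tendsto_intros f)
    moreover have "0 \<le> v \<bullet> (f n - v)" for n
      using f(1)[of n] v(2) by auto
    ultimately show ?thesis
      by (intro LIMSEQ_le_const) auto
  qed
  have gap: "(norm (w - v))\<^sup>2 \<le> (norm w)\<^sup>2 - (norm v)\<^sup>2" if "w \<in> closure ?R" for w
    using var[OF that]
    by (simp add: power2_norm_eq_inner inner_diff_left inner_diff_right inner_commute)
  have min: "norm v \<le> norm w" if "w \<in> closure ?R" for w
  proof (rule power2_le_imp_le)
    show "(norm v)\<^sup>2 \<le> (norm w)\<^sup>2"
      using gap[OF that] zero_le_power2[of "norm (w - v)"] by linarith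
  qed simp
  have "infimal_displacement X T = v"
    unfolding infimal_displacement_def
  proof (rule the_equality)
    show "is_arg_min norm (\<lambda>w. w \<in> closure ?R) v"
      using v(1) min by (auto simp: is_arg_min_linorder)
    fix w assume "is_arg_min norm (\<lambda>w. w \<in> closure ?R) w"
    then have w: "w \<in> closure ?R" and "norm w \<le> norm v"
      using v(1) by (auto simp: is_arg_min_linorder)
    then have "(norm w)\<^sup>2 \<le> (norm v)\<^sup>2"
      by (intro power_mono) auto
    with gap[OF w] have "(norm (w - v))\<^sup>2 \<le> 0" by linarith
    then show "w = v" by simp
  qed
  then show "infimal_displacement X T \<in> closure ?R"
    and "y \<in> X \<Longrightarrow> 0 \<le> infimal_displacement X T \<bullet> ((y - T y) - infimal_displacement X T)"
    using v by auto
qed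

section \<open>Direct sums and block updates\<close>

lemma subspace_direct_sum:
  assumes "\<And>i. subspace (H i)"
  shows "subspace (direct_sum H)"
  using assms by (auto simp: direct_sum_def subspace_def)

lemma complete_direct_sum:
  assumes "\<And>i. complete (H i)"
  shows "complete (direct_sum H)"
proof (rule completeI)
  fix f assume f: "\<forall>n. f n \<in> direct_sum H" "Cauchy f"
  have "Cauchy (\<lambda>n. f n $ i)" for i
    using f(2) by (rule Cauchy_vec_nth)
  then have "\<forall>i. \<exists>l\<in>H i. (\<lambda>n. f n $ i) \<longlonglongrightarrow> l"
    using assms f(1) unfolding complete_def direct_sum_def by fastforce
  then obtain l where l: "\<And>i. l i \<in> H i" "\<And>i. (\<lambda>n. f n $ i) \<longlonglongrightarrow> l i"
    by metis
  have "f \<longlonglongrightarrow> (\<chi> i. l i)"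
    by (rule vec_tendstoI) (simp add: l)
  moreover have "(\<chi> i. l i) \<in> direct_sum H"
    by (simp add: direct_sum_def l)
  ultimately show "\<exists>l\<in>direct_sum H. f \<longlonglongrightarrow> l" by blast
qed

lemma power2_norm_vec: "(norm x)\<^sup>2 = (\<Sum>i\<in>UNIV. (norm (x $ i))\<^sup>2)"
  for x :: "'b::real_inner^'m::finite"
  by (simp add: power2_norm_eq_inner inner_vec_def)

text \<open>
  The parameter \<open>\<theta>\<close> cancels in the partial update \<open>T_sel\<close>; this form exhibits what is left.
\<close>

definition block_step :: "('b::real_inner^'m::finite \<Rightarrow> 'b^'m) \<Rightarrow> real^'m \<Rightarrow> 'b^'m \<Rightarrow> 'b^'m" where
  "block_step T p y = y - (\<chi> i. p $ i *\<^sub>R (y - T y) $ i)"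

lemma T_sel_eq_block_step:
  assumes "\<theta> \<noteq> 0"
  shows "T_sel \<theta> T p y = block_step T p y"
proof -
  have "S_sel \<theta> T p y = (\<chi> i. p $ i *\<^sub>R (S_op \<theta> T y) $ i)"
    by (simp add: S_sel_def S_block_def vec_eq_iff axis_def if_distrib cong: if_cong)
  then show ?thesis
    using assms by (simp add: T_sel_def block_step_def S_op_def vec_eq_iff)
qed

lemma block_step_in_direct_sum:
  assumes "\<And>i. subspace (H i)" and "T \<in> direct_sum H \<rightarrow> direct_sum H" and "y \<in> direct_sum H"
  shows "block_step T p y \<in> direct_sum H"
proof -
  have "T y \<in> direct_sum H" using assms by auto
  with assms show ?thesis
    by (auto simp: block_step_def direct_sum_def intro!: subspace_diff subspace_scale)
qed

lemma continuous_on_block_step: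
  assumes "continuous_on X T"
  shows "continuous_on (UNIV \<times> X) (\<lambda>(p, y). block_step T p y)"
proof -
  have "continuous_on (UNIV \<times> X) (\<lambda>z. T (snd z))"
    by (rule continuous_on_compose2[OF assms]) (auto intro!: continuous_intros)
  then show ?thesis
    unfolding block_step_def case_prod_unfold by (intro continuous_intros)
qed

text \<open>
  Blockwise, the square of \<open>p\<^sub>i\<close> that the expansion produces is replaced by \<open>p\<^sub>i\<close>. The bound is then
  affine in \<open>p\<close>, so that its expectation for a random \<open>p\<close> depends only on the mean.
\<close>

lemma norm_partial_update_le:
  fixes y w :: "'b::real_inner^'m::finite"
  assumes "\<And>i. p $ i \<in> {0..1}"
  shows "(norm (y - (\<chi> i. p $ i *\<^sub>R w $ i)))\<^sup>2
    \<le> (norm y)\<^sup>2 + (\<Sum>i\<in>UNIV. p $ i * ((norm (w $ i))\<^sup>2 - 2 * (y $ i \<bullet> w $ i)))"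
proof -
  have "(norm (y $ i - p $ i *\<^sub>R w $ i))\<^sup>2
      \<le> (norm (y $ i))\<^sup>2 + p $ i * ((norm (w $ i))\<^sup>2 - 2 * (y $ i \<bullet> w $ i))" for i
  proof -
    have "p $ i * p $ i \<le> p $ i"
      using assms[of i] by (simp add: mult_left_le)
    then have "p $ i * p $ i * (norm (w $ i))\<^sup>2 \<le> p $ i * (norm (w $ i))\<^sup>2"
      by (intro mult_right_mono) auto
    then show ?thesis
      by (simp add: power2_norm_eq_inner inner_diff_left inner_diff_right inner_commute algebra_simps)
  qed
  then have "(\<Sum>i\<in>UNIV. (norm (y $ i - p $ i *\<^sub>R w $ i))\<^sup>2) \<le> (\<Sum>i\<in>UNIV. (norm (y $ i))\<^sup>2
      + p $ i * ((norm (w $ i))\<^sup>2 - 2 * (y $ i \<bullet> w $ i)))"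
    by (rule sum_mono)
  then show ?thesis
    by (simp add: power2_norm_vec sum.distrib)
qed

text \<open>
  The left-hand side is the bound of \<open>norm_partial_update_le\<close> for \<open>y = r + \<alpha> v\<close>, with every
  entry of the selection replaced by its mean \<open>\<alpha>\<close>. Split \<open>x - T x - v\<close> into \<open>s\<close>, the difference of the
  displacements of \<open>x\<close> and \<open>z\<close>, and the small rest \<open>t\<close>. Cocoercivity absorbs \<open>\<parallel>s\<parallel>\<^sup>2\<close>. The terms
  of second order in the update contribute \<open>2 \<alpha> (1 - \<alpha>) \<langle>v, s + t\<rangle>\<close>, which may be of the order of \<open>\<parallel>x\<parallel>\<close>; the
  drift term \<open>\<kappa> v\<close> in \<open>r\<close> compensates it as soon as \<open>\<kappa> \<ge> 1 - \<alpha>\<close>. The constant \<open>6\<close> is \<open>2\<close> from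
  \<open>\<langle>x - z, t\<rangle>\<close> plus \<open>4\<close> from \<open>2 \<langle>s, t\<rangle>\<close>.
\<close>

lemma mean_update_bound:
  fixes T :: "'a::real_inner \<Rightarrow> 'a"
  assumes lip: "1-lipschitz_on X T" and X: "x \<in> X" "z \<in> X"
    and z: "norm ((z - T z) - v) \<le> \<epsilon>"
    and v: "0 \<le> v \<bullet> ((x - T x) - v)"
    and \<alpha>: "0 \<le> \<alpha>" "\<alpha> \<le> 1" and \<kappa>: "1 \<le> \<kappa>"
  defines "r \<equiv> x - z + \<kappa> *\<^sub>R v"
  shows "(norm (r + \<alpha> *\<^sub>R v))\<^sup>2
      + \<alpha> * ((norm (x - T x))\<^sup>2 - 2 * ((r + \<alpha> *\<^sub>R v) \<bullet> (x - T x)))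
    \<le> (norm r)\<^sup>2 + (6 * \<epsilon> * norm (x - z) + \<epsilon>\<^sup>2 + (norm v)\<^sup>2)"
proof -
  define e s t where "e = x - z" and "s = (x - T x) - (z - T z)" and "t = (z - T z) - v"
  have p: "x - T x = s + t + v" by (simp add: s_def t_def)
  have r: "r = e + \<kappa> *\<^sub>R v" by (simp add: r_def e_def)
  have "norm (T x - T z) \<le> norm e"
    using lipschitz_onD[OF lip X] by (simp add: dist_norm e_def)
  moreover have "s = e - (T x - T z)" by (simp add: s_def e_def)
  ultimately have s_le: "norm s \<le> 2 * norm e"
    using norm_triangle_ineq4[of e "T x - T z"] by simp
  have t_le: "norm t \<le> \<epsilon>" using z by (simp add: t_def)
  have coco: "(norm s)\<^sup>2 \<le> 2 * (e \<bullet> s)"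
    using displacement_cocoercive[OF lip X] by (simp add: s_def e_def inner_commute)
  have et: "- (e \<bullet> t) \<le> \<epsilon> * norm e"
    using norm_cauchy_schwarz[of "- e" t] mult_left_mono[OF t_le norm_ge_zero[of e]]
    by (simp add: mult.commute)
  have st: "s \<bullet> t \<le> 2 * \<epsilon> * norm e"
  proof -
    have "s \<bullet> t \<le> norm s * norm t" by (rule norm_cauchy_schwarz)
    also have "\<dots> \<le> (2 * norm e) * \<epsilon>"
      using s_le t_le by (intro mult_mono) auto
    finally show ?thesis by (simp add: mult_ac)
  qed
  have tt: "(norm t)\<^sup>2 \<le> \<epsilon>\<^sup>2"
    using t_le by (simp add: power_mono)
  have vq: "0 \<le> v \<bullet> (s + t)" using v by (simp add: p)
  have "(norm (r + \<alpha> *\<^sub>R v))\<^sup>2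
      + \<alpha> * ((norm (x - T x))\<^sup>2 - 2 * ((r + \<alpha> *\<^sub>R v) \<bullet> (x - T x))) - (norm r)\<^sup>2
    = \<alpha> * (((norm s)\<^sup>2 - 2 * (e \<bullet> s)) - 2 * (e \<bullet> t) + 2 * (s \<bullet> t) + (norm t)\<^sup>2
        - 2 * (\<kappa> - (1 - \<alpha>)) * (v \<bullet> (s + t)) + (1 - \<alpha>) * (norm v)\<^sup>2)"
    unfolding p r
    by (simp add: power2_norm_eq_inner inner_add_left inner_add_right inner_diff_left
        inner_diff_right inner_commute algebra_simps)
  also have "\<dots> \<le> \<alpha> * (6 * \<epsilon> * norm e + \<epsilon>\<^sup>2 + (norm v)\<^sup>2)"
  proof (rule mult_left_mono)
    have "0 \<le> (\<kappa> - (1 - \<alpha>)) * (v \<bullet> (s + t))"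
      using vq \<alpha> \<kappa> by (intro mult_nonneg_nonneg) auto
    moreover have "(1 - \<alpha>) * (norm v)\<^sup>2 \<le> (norm v)\<^sup>2"
      using \<alpha> by (intro mult_left_le_one_le) auto
    ultimately show "((norm s)\<^sup>2 - 2 * (e \<bullet> s)) - 2 * (e \<bullet> t) + 2 * (s \<bullet> t) + (norm t)\<^sup>2
        - 2 * (\<kappa> - (1 - \<alpha>)) * (v \<bullet> (s + t)) + (1 - \<alpha>) * (norm v)\<^sup>2
      \<le> 6 * \<epsilon> * norm e + \<epsilon>\<^sup>2 + (norm v)\<^sup>2"
      using coco et st tt unfolding mult.assoc by linarith
  qed (use \<alpha> in auto)
  also have "\<dots> \<le> 6 * \<epsilon> * norm e + \<epsilon>\<^sup>2 + (norm v)\<^sup>2"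
  proof (rule mult_left_le_one_le)
    have "0 \<le> \<epsilon>" using t_le norm_ge_zero[of t] by linarith
    then show "0 \<le> 6 * \<epsilon> * norm e + \<epsilon>\<^sup>2 + (norm v)\<^sup>2" by simp
  qed (use \<alpha> in auto)
  finally show ?thesis by (simp add: e_def)
qed

section \<open>Iterations driven by independent selections\<close>

text \<open>
  Displaying the iterate as a function of the whole selection sequence separates its analytic
  properties from the probability space.
\<close>

primrec drive :: "('p \<Rightarrow> 'a \<Rightarrow> 'a) \<Rightarrow> 'a \<Rightarrow> nat \<Rightarrow> (nat \<Rightarrow> 'p) \<Rightarrow> 'a" where
  "drive F x0 0 p = x0"
| "drive F x0 (Suc k) p = F (p k) (drive F x0 k p)"

lemma drive_cong:
  "(\<And>j. j < k \<Longrightarrow> p j = q j) \<Longrightarrow> drive F x0 k p = drive F x0 k q"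
  by (induction k) auto

lemma drive_in:
  assumes "\<And>p y. y \<in> X \<Longrightarrow> F p y \<in> X" and "x0 \<in> X"
  shows "drive F x0 k p \<in> X"
  using assms by (induction k) auto

text \<open>
  Continuity is with respect to the product topology on the selection sequences.
\<close>

lemma continuous_on_drive:
  fixes F :: "'p::topological_space \<Rightarrow> 'a::topological_space \<Rightarrow> 'a"
  assumes "continuous_on (UNIV \<times> X) (\<lambda>(p, y). F p y)"
    and "\<And>p y. y \<in> X \<Longrightarrow> F p y \<in> X" and "x0 \<in> X"
  shows "continuous_on UNIV (drive F x0 k)"
proof (induction k)
  case 0
  show ?case by simp
next
  case (Suc k)
  have "continuous_on UNIV (\<lambda>p. (p k, drive F x0 k p))"
    by (intro continuous_on_Pair Suc continuous_on_product_coordinates)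
  moreover have "(\<lambda>p. (p k, drive F x0 k p)) ` UNIV \<subseteq> UNIV \<times> X"
    using drive_in[OF assms(2,3)] by auto
  ultimately have "continuous_on UNIV (\<lambda>p. (\<lambda>(p, y). F p y) (p k, drive F x0 k p))"
    using continuous_on_compose2[OF assms(1)] by blast
  then show ?case by simp
qed

text \<open>
  By compactness, continuous functions of the selection sequence are bounded on the sequences that
  occur, which makes them integrable.
\<close>

lemma compact_unit_cubes: "compact {p :: nat \<Rightarrow> real^'m::finite. \<forall>j i. p j $ i \<in> {0..1}}"
proof -
  have "compactin (product_topology (\<lambda>_. euclidean) UNIV) (PiE UNIV (\<lambda>_::nat. cbox (0::real^'m) 1))"
    by (auto simp: compactin_PiE)
  moreover have "PiE UNIV (\<lambda>_::nat. cbox (0::real^'m) 1) = {p. \<forall>j i. p j $ i \<in> {0..1}}"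
    by (auto simp: PiE_def Pi_def mem_box_cart)
  ultimately show ?thesis
    by (simp add: euclidean_product_topology)
qed

locale iid_selection = prob_space M for M :: "'w measure" +
  fixes I :: "nat \<Rightarrow> 'w \<Rightarrow> real^'m::finite" and \<alpha> :: real
  assumes indep: "indep_vars (\<lambda>_. borel) I UNIV"
    and identically_distributed: "\<And>k. distr M borel (I k) = distr M borel (I 0)"
    and unit_cube: "\<And>k \<omega> i. \<omega> \<in> space M \<Longrightarrow> I k \<omega> $ i \<in> {0..1}"
    and mean: "expectation (I 0) = \<alpha> *\<^sub>R 1"
begin

lemma measurable_selection [measurable]: "I k \<in> borel_measurable M"
  using indep by (auto simp: indep_vars_def)

lemma integrable_selection: "integrable M (I k)"
proof (rule integrable_const_bound[of _ "real CARD('m)"])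
  show "AE \<omega> in M. norm (I k \<omega>) \<le> real CARD('m)"
  proof (rule AE_I2)
    fix \<omega> assume "\<omega> \<in> space M"
    have "norm (I k \<omega>) \<le> (\<Sum>i\<in>UNIV. \<bar>I k \<omega> $ i\<bar>)"
      by (rule norm_le_l1_cart)
    also have "\<dots> \<le> (\<Sum>i\<in>(UNIV::'m set). 1)"
      using unit_cube[OF \<open>\<omega> \<in> space M\<close>] by (intro sum_mono) auto
    finally show "norm (I k \<omega>) \<le> real CARD('m)" by simp
  qed
qed simp

lemma integrable_selection_component: "integrable M (\<lambda>\<omega>. I k \<omega> $ i)"
  by (rule integrable_bounded_linear[OF bounded_linear_vec_nth integrable_selection])

lemma expectation_selection_component: "expectation (\<lambda>\<omega>. I k \<omega> $ i) = \<alpha>"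
proof -
  have "expectation (\<lambda>\<omega>. I k \<omega> $ i) = integral\<^sup>L (distr M borel (I k)) (\<lambda>p. p $ i)"
    by (subst integral_distr) auto
  also have "\<dots> = integral\<^sup>L (distr M borel (I 0)) (\<lambda>p. p $ i)"
    by (simp only: identically_distributed[of k])
  also have "\<dots> = expectation (\<lambda>\<omega>. I 0 \<omega> $ i)"
    by (subst integral_distr) auto
  also have "\<dots> = expectation (I 0) $ i"
    by (rule integral_bounded_linear[OF bounded_linear_vec_nth integrable_selection])
  finally show ?thesis by (simp add: mean)
qed

text \<open>
  The state space may be non-separable, so vector-valued measurability of the iterates is avoided:
  a real continuous function of the \<open>k\<close>th iterate is a real continuous function of the selection
  sequence. The Borel sets of the space of sequences are those of the product measure, since
  \<open>real^'m\<close> is second countable. Only the first \<open>k\<close> selections matter, and they are independent of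
  the selection with index \<open>k\<close>.
\<close>

lemma
  fixes F :: "real^'m \<Rightarrow> 'a::topological_space \<Rightarrow> 'a" and g :: "'a \<Rightarrow> real"
  assumes F: "continuous_on (UNIV \<times> X) (\<lambda>(p, y). F p y)" "\<And>p y. y \<in> X \<Longrightarrow> F p y \<in> X"
    and x0: "x0 \<in> X" and g: "continuous_on X g"
  shows integrable_driven: "integrable M (\<lambda>\<omega>. g (drive F x0 k (\<lambda>j. I j \<omega>)))"
    and integrable_selection_times_driven:
      "integrable M (\<lambda>\<omega>. I k \<omega> $ i * g (drive F x0 k (\<lambda>j. I j \<omega>)))"
    and expectation_selection_times_driven:
      "expectation (\<lambda>\<omega>. I k \<omega> $ i * g (drive F x0 k (\<lambda>j. I j \<omega>)))
        = \<alpha> * expectation (\<lambda>\<omega>. g (drive F x0 k (\<lambda>j. I j \<omega>)))"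
proof -
  define h where "h p = g (drive F x0 k p)" for p
  have h_cont: "continuous_on UNIV h"
    unfolding h_def using continuous_on_drive[OF F x0] drive_in[OF F(2) x0]
    by (intro continuous_on_compose2[OF g]) auto
  let ?hist = "\<lambda>\<omega>. restrict (\<lambda>j. I j \<omega>) {..<k}"
  let ?pad = "\<lambda>p j. if j < k then p j else (0::real^'m)"
  have "h \<in> borel_measurable borel"
    by (rule borel_measurable_continuous_onI[OF h_cont])
  then have "h \<in> borel_measurable (PiM UNIV (\<lambda>_. borel))"
    using measurable_cong_sets[OF sets_PiM_equal_borel refl] by blast
  moreover have "?pad \<in> measurable (PiM {..<k} (\<lambda>_. borel)) (PiM UNIV (\<lambda>_. borel))"
  proof (rule measurable_PiM_single')
    show "(\<lambda>f. ?pad f j) \<in> borel_measurable (PiM {..<k} (\<lambda>_. borel))" for j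
      by (cases "j < k") simp_all
  qed (auto simp: space_PiM)
  ultimately have h_pad: "h \<circ> ?pad \<in> borel_measurable (PiM {..<k} (\<lambda>_. borel))"
    by (rule measurable_comp[rotated])
  have h_hist: "h (\<lambda>j. I j \<omega>) = (h \<circ> ?pad) (?hist \<omega>)" for \<omega>
    unfolding h_def o_def by (subst drive_cong[of k "\<lambda>j. I j \<omega>" "?pad (?hist \<omega>)"]) auto
  have "indep_var (PiM {k} (\<lambda>_. borel)) (\<lambda>\<omega>. restrict (\<lambda>j. I j \<omega>) {k})
      (PiM {..<k} (\<lambda>_. borel)) ?hist"
    by (rule indep_var_restrict[OF indep]) auto
  then have "indep_var borel ((\<lambda>f. f k $ i) \<circ> (\<lambda>\<omega>. restrict (\<lambda>j. I j \<omega>) {k}))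
      borel ((h \<circ> ?pad) \<circ> ?hist)"
  proof (rule indep_var_compose[OF _ _ h_pad])
    show "(\<lambda>f. f k $ i) \<in> borel_measurable (PiM {k} (\<lambda>_. borel))"
      by (rule measurable_compose[OF measurable_component_singleton])
        (auto intro!: borel_measurable_continuous_onI continuous_intros)
  qed
  then have ind: "indep_var borel (\<lambda>\<omega>. I k \<omega> $ i) borel (\<lambda>\<omega>. h (\<lambda>j. I j \<omega>))"
    by (simp add: h_hist comp_def)
  have h_meas: "(\<lambda>\<omega>. h (\<lambda>j. I j \<omega>)) \<in> borel_measurable M"
    using ind by (rule indep_var_rv2)
  have "bounded (h ` {p. \<forall>j i. p j $ i \<in> {0..1}})"
    using compact_unit_cubes h_cont
    by (intro compact_imp_bounded compact_continuous_image) (auto intro: continuous_on_subset)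
  then obtain B where B: "\<And>p. \<forall>j i. p j $ i \<in> {0..1} \<Longrightarrow> norm (h p) \<le> B"
    unfolding bounded_iff by blast
  have h_int: "integrable M (\<lambda>\<omega>. h (\<lambda>j. I j \<omega>))"
    using B unit_cube h_meas by (intro integrable_const_bound[of _ B] AE_I2) auto
  show "integrable M (\<lambda>\<omega>. g (drive F x0 k (\<lambda>j. I j \<omega>)))"
    using h_int by (simp add: h_def)
  show "integrable M (\<lambda>\<omega>. I k \<omega> $ i * g (drive F x0 k (\<lambda>j. I j \<omega>)))"
    using indep_var_integrable[OF ind integrable_selection_component h_int] by (simp add: h_def)
  show "expectation (\<lambda>\<omega>. I k \<omega> $ i * g (drive F x0 k (\<lambda>j. I j \<omega>)))
        = \<alpha> * expectation (\<lambda>\<omega>. g (drive F x0 k (\<lambda>j. I j \<omega>)))"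
    using indep_var_lebesgue_integral[OF ind integrable_selection_component h_int]
    by (simp add: h_def expectation_selection_component)
qed

end

section \<open>Growth of the second moment\<close>

text \<open>
  Averagedness enters the growth estimate through non-expansiveness, and the minimality of \<open>v\<close>
  through the variational inequality.
\<close>

locale random_block_iteration = iid_selection M I \<alpha>
  for M :: "'w measure" and I :: "nat \<Rightarrow> 'w \<Rightarrow> real^'m::finite" and \<alpha> :: real +
  fixes H :: "'m \<Rightarrow> 'b::real_inner set" and T :: "'b^'m \<Rightarrow> 'b^'m" and x0 v :: "'b^'m"
  assumes \<alpha>: "0 \<le> \<alpha>" "\<alpha> \<le> 1"
    and H: "\<And>i. subspace (H i)"
    and T: "T \<in> direct_sum H \<rightarrow> direct_sum H"
    and nonexpansive: "1-lipschitz_on (direct_sum H) T"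
    and x0: "x0 \<in> direct_sum H"
    and v: "v \<in> closure ((\<lambda>y. y - T y) ` direct_sum H)"
    and variational: "\<And>y. y \<in> direct_sum H \<Longrightarrow> 0 \<le> v \<bullet> ((y - T y) - v)"
begin

definition iterate :: "nat \<Rightarrow> 'w \<Rightarrow> 'b^'m" where
  "iterate k \<omega> = drive (block_step T) x0 k (\<lambda>j. I j \<omega>)"

lemma iterate_in: "iterate k \<omega> \<in> direct_sum H"
  unfolding iterate_def by (intro drive_in block_step_in_direct_sum H T x0)

lemma continuous_on_T: "continuous_on (direct_sum H) T"
  using nonexpansive by (rule lipschitz_on_continuous_on)

lemma
  assumes "continuous_on (direct_sum H) g"
  shows integrable_iterate: "integrable M (\<lambda>\<omega>. g (iterate k \<omega>) :: real)"
    and integrable_selection_times_iterate: "integrable M (\<lambda>\<omega>. I k \<omega> $ i * g (iterate k \<omega>))"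
    and expectation_selection_times_iterate:
      "expectation (\<lambda>\<omega>. I k \<omega> $ i * g (iterate k \<omega>)) = \<alpha> * expectation (\<lambda>\<omega>. g (iterate k \<omega>))"
  unfolding iterate_def
  using integrable_driven[OF continuous_on_block_step[OF continuous_on_T]
      block_step_in_direct_sum[OF H T] x0 assms]
    integrable_selection_times_driven[OF continuous_on_block_step[OF continuous_on_T]
      block_step_in_direct_sum[OF H T] x0 assms]
    expectation_selection_times_driven[OF continuous_on_block_step[OF continuous_on_T]
      block_step_in_direct_sum[OF H T] x0 assms]
  by auto

text \<open>
  The offset \<open>1\<close> in the drift makes the coefficient \<open>\<kappa> = k \<alpha> + 1\<close> at least \<open>1\<close>, as
  \<open>mean_update_bound\<close> needs it, from the start.
\<close>

definition deviation :: "'b^'m \<Rightarrow> nat \<Rightarrow> 'w \<Rightarrow> 'b^'m" where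
  "deviation z k \<omega> = iterate k \<omega> - z + (real k * \<alpha> + 1) *\<^sub>R v"

lemma integrable_deviation:
  "integrable M (\<lambda>\<omega>. norm (deviation z k \<omega>))" "integrable M (\<lambda>\<omega>. (norm (deviation z k \<omega>))\<^sup>2)"
  "integrable M (\<lambda>\<omega>. norm (iterate k \<omega> - z))"
  unfolding deviation_def
  by (rule integrable_iterate[of "\<lambda>y. norm (y - z + (real k * \<alpha> + 1) *\<^sub>R v)"]
    integrable_iterate[of "\<lambda>y. (norm (y - z + (real k * \<alpha> + 1) *\<^sub>R v))\<^sup>2"]
    integrable_iterate[of "\<lambda>y. norm (y - z)"]; intro continuous_intros)+

text \<open>
  The deviation after the step is \<open>Y - D\<close>, where \<open>Y\<close> is the old deviation plus \<open>\<alpha> v\<close> and \<open>D\<close> is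
  the partial update. Bound its square by an affine function of the selection, insert the mean by
  independence, and apply \<open>mean_update_bound\<close> pointwise.
\<close>

lemma second_moment_step:
  assumes z: "z \<in> direct_sum H" "norm ((z - T z) - v) \<le> \<epsilon>"
  shows "expectation (\<lambda>\<omega>. (norm (deviation z (Suc k) \<omega>))\<^sup>2)
    \<le> expectation (\<lambda>\<omega>. (norm (deviation z k \<omega>))\<^sup>2)
      + (6 * \<epsilon> * expectation (\<lambda>\<omega>. norm (iterate k \<omega> - z)) + \<epsilon>\<^sup>2 + (norm v)\<^sup>2)"
proof -
  define Y where "Y a = a - z + (real k * \<alpha> + 1) *\<^sub>R v + \<alpha> *\<^sub>R v" for a
  define g where "g i a = (norm ((a - T a) $ i))\<^sup>2 - 2 * (Y a $ i \<bullet> (a - T a) $ i)" for i a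
  have Y_cont: "continuous_on (direct_sum H) Y"
    unfolding Y_def by (intro continuous_intros)
  have g_cont: "continuous_on (direct_sum H) (g i)" for i
    unfolding g_def by (intro continuous_intros Y_cont continuous_on_T)
  have Y_int: "integrable M (\<lambda>\<omega>. (norm (Y (iterate k \<omega>)))\<^sup>2)"
    by (rule integrable_iterate[of "\<lambda>y. (norm (Y y))\<^sup>2"]) (intro continuous_intros Y_cont)
  note ints = Y_int integrable_selection_times_iterate[OF g_cont] integrable_iterate[OF g_cont]
    integrable_deviation
  have "(norm (deviation z (Suc k) \<omega>))\<^sup>2
      \<le> (norm (Y (iterate k \<omega>)))\<^sup>2 + (\<Sum>i\<in>UNIV. I k \<omega> $ i * g i (iterate k \<omega>))"
    if "\<omega> \<in> space M" for \<omega>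
  proof -
    let ?a = "iterate k \<omega>"
    have dev: "deviation z (Suc k) \<omega> = Y ?a - (\<chi> i. I k \<omega> $ i *\<^sub>R (?a - T ?a) $ i)"
      by (simp add: deviation_def iterate_def block_step_def Y_def algebra_simps)
    show ?thesis
      unfolding dev g_def by (rule norm_partial_update_le) (rule unit_cube[OF that])
  qed
  then have "expectation (\<lambda>\<omega>. (norm (deviation z (Suc k) \<omega>))\<^sup>2)
      \<le> expectation (\<lambda>\<omega>. (norm (Y (iterate k \<omega>)))\<^sup>2 + (\<Sum>i\<in>UNIV. I k \<omega> $ i * g i (iterate k \<omega>)))"
    by (intro integral_mono Bochner_Integration.integrable_add Bochner_Integration.integrable_sum ints)
  also have "\<dots> = expectation (\<lambda>\<omega>. (norm (Y (iterate k \<omega>)))\<^sup>2)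
      + (\<Sum>i\<in>UNIV. \<alpha> * expectation (\<lambda>\<omega>. g i (iterate k \<omega>)))"
    by (simp add: ints Bochner_Integration.integral_sum expectation_selection_times_iterate[OF g_cont])
  also have "\<dots> = expectation (\<lambda>\<omega>. (norm (Y (iterate k \<omega>)))\<^sup>2
      + \<alpha> * (\<Sum>i\<in>UNIV. g i (iterate k \<omega>)))"
    by (simp add: ints Bochner_Integration.integral_sum sum_distrib_left)
  also have "\<dots> \<le> expectation (\<lambda>\<omega>. (norm (deviation z k \<omega>))\<^sup>2
      + (6 * \<epsilon> * norm (iterate k \<omega> - z) + \<epsilon>\<^sup>2 + (norm v)\<^sup>2))"
  proof (rule integral_mono)
    show "integrable M (\<lambda>\<omega>. (norm (Y (iterate k \<omega>)))\<^sup>2 + \<alpha> * (\<Sum>i\<in>UNIV. g i (iterate k \<omega>)))"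
      by (intro Bochner_Integration.integrable_add integrable_mult_right Bochner_Integration.integrable_sum ints)
    show "integrable M (\<lambda>\<omega>. (norm (deviation z k \<omega>))\<^sup>2
      + (6 * \<epsilon> * norm (iterate k \<omega> - z) + \<epsilon>\<^sup>2 + (norm v)\<^sup>2))"
      by (intro Bochner_Integration.integrable_add integrable_mult_right integrable_const ints)
    fix \<omega>
    let ?a = "iterate k \<omega>"
    have "(\<Sum>i\<in>UNIV. g i ?a) = (norm (?a - T ?a))\<^sup>2 - 2 * (Y ?a \<bullet> (?a - T ?a))"
      by (simp add: g_def power2_norm_vec inner_vec_def sum_subtractf sum_distrib_left)
    then show "(norm (Y ?a))\<^sup>2 + \<alpha> * (\<Sum>i\<in>UNIV. g i ?a) \<le> (norm (deviation z k \<omega>))\<^sup>2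
      + (6 * \<epsilon> * norm (?a - z) + \<epsilon>\<^sup>2 + (norm v)\<^sup>2)"
      using mean_update_bound[OF nonexpansive iterate_in z variational[OF iterate_in] \<alpha>,
          of "real k * \<alpha> + 1" k \<omega>] \<alpha>
      by (simp add: Y_def deviation_def)
  qed
  also have "\<dots> = expectation (\<lambda>\<omega>. (norm (deviation z k \<omega>))\<^sup>2)
      + (6 * \<epsilon> * expectation (\<lambda>\<omega>. norm (iterate k \<omega> - z)) + \<epsilon>\<^sup>2 + (norm v)\<^sup>2)"
    by (simp add: ints prob_space)
  finally show ?thesis .
qed

text \<open>
  The square \<open>(c k + d)\<^sup>2\<close> increases by \<open>(2 k + 1) c\<^sup>2 + 2 c d\<close> in one step. The choice of \<open>\<epsilon>\<close> keeps
  the part of the increment of the second moment that grows with \<open>k\<close> below \<open>(k + 1) c\<^sup>2\<close>, and the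
  choice of \<open>d\<close> covers the constant part and the initial value.
\<close>

lemma second_moment_growth:
  assumes c: "0 < c" "c \<le> 1"
  shows "\<exists>z\<in>direct_sum H. \<exists>d. \<forall>k. expectation (\<lambda>\<omega>. (norm (deviation z k \<omega>))\<^sup>2) \<le> (c * real k + d)\<^sup>2"
proof -
  define V where "V = norm v"
  have V: "0 \<le> V" by (simp add: V_def)
  define \<epsilon> where "\<epsilon> = c\<^sup>2 / (6 * (1 + V))"
  have \<epsilon>: "0 < \<epsilon>" using c V by (simp add: \<epsilon>_def)
  have \<epsilon>_c: "6 * \<epsilon> * (1 + V) = c\<^sup>2" using V by (simp add: \<epsilon>_def field_simps)
  have c2: "c\<^sup>2 \<le> c" using c by (simp add: power2_eq_square mult_left_le)
  have "6 * \<epsilon> * 1 \<le> 6 * \<epsilon> * (1 + V)" using \<epsilon> V by (intro mult_left_mono) auto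
  then have \<epsilon>_le: "6 * \<epsilon> \<le> c\<^sup>2" using \<epsilon>_c by simp
  have "\<epsilon> \<le> 1" using \<epsilon>_le c2 c \<epsilon> by linarith
  then have \<epsilon>2: "\<epsilon>\<^sup>2 \<le> 1" using \<epsilon> by (simp add: power_le_one)
  obtain w where "w \<in> (\<lambda>y. y - T y) ` direct_sum H" and w: "dist w v < \<epsilon>"
    using v \<epsilon> unfolding closure_approachable by blast
  then obtain z where z: "z \<in> direct_sum H" "norm ((z - T z) - v) \<le> \<epsilon>"
    by (auto simp: dist_norm)
  define d where "d = (1 + V\<^sup>2) / c + norm (x0 - z + v)"
  have "0 < (1 + V\<^sup>2) / c"
    using c by (intro divide_pos_pos add_pos_nonneg) auto
  moreover have "c * d = 1 + V\<^sup>2 + c * norm (x0 - z + v)"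
    using c by (simp add: d_def field_simps)
  ultimately have d: "0 < d" "1 + V\<^sup>2 \<le> c * d"
    using c by (auto simp: d_def intro: add_pos_nonneg)
  have "expectation (\<lambda>\<omega>. (norm (deviation z k \<omega>))\<^sup>2) \<le> (c * real k + d)\<^sup>2" for k
  proof (induction k)
    case 0
    have "norm (x0 - z + v) \<le> d" using c by (simp add: d_def)
    then have "(norm (x0 - z + v))\<^sup>2 \<le> d\<^sup>2" by (simp add: power_mono)
    then show ?case by (simp add: deviation_def iterate_def prob_space)
  next
    case (Suc k)
    define b where "b = c * real k + d"
    have b: "0 < b" using c d by (simp add: b_def add_nonneg_pos)
    \<comment> \<open>The arithmetic-geometric mean inequality with weight \<open>b\<close> bounds the first moment by \<open>b\<close>,
      given the bound \<open>b\<^sup>2\<close> on the second.\<close>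
    have "expectation (\<lambda>\<omega>. norm (deviation z k \<omega>))
        \<le> expectation (\<lambda>\<omega>. ((norm (deviation z k \<omega>))\<^sup>2 / b + b) / 2)"
    proof (intro integral_mono)
      fix \<omega>
      have "2 * norm (deviation z k \<omega>) * b \<le> (norm (deviation z k \<omega>))\<^sup>2 + b\<^sup>2"
        using sum_squares_bound by blast
      then show "norm (deviation z k \<omega>) \<le> ((norm (deviation z k \<omega>))\<^sup>2 / b + b) / 2"
        using b by (simp add: field_simps power2_eq_square)
    qed (auto intro!: integrable_deviation Bochner_Integration.integrable_add)
    also have "\<dots> = (expectation (\<lambda>\<omega>. (norm (deviation z k \<omega>))\<^sup>2) / b + b) / 2"
      by (simp add: integrable_deviation prob_space)
    also have "\<dots> \<le> (b\<^sup>2 / b + b) / 2"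
      using Suc b by (intro divide_right_mono add_right_mono) (auto simp: b_def)
    also have "\<dots> = b" using b by (simp add: power2_eq_square)
    finally have dev: "expectation (\<lambda>\<omega>. norm (deviation z k \<omega>)) \<le> b" .
    have "expectation (\<lambda>\<omega>. norm (iterate k \<omega> - z))
        \<le> expectation (\<lambda>\<omega>. norm (deviation z k \<omega>) + (real k + 1) * V)"
    proof (intro integral_mono)
      fix \<omega>
      have "iterate k \<omega> - z = deviation z k \<omega> - (real k * \<alpha> + 1) *\<^sub>R v"
        by (simp add: deviation_def)
      then have "norm (iterate k \<omega> - z) \<le> norm (deviation z k \<omega>) + norm ((real k * \<alpha> + 1) *\<^sub>R v)"
        by (simp only: norm_triangle_ineq4)
      also have "norm ((real k * \<alpha> + 1) *\<^sub>R v) = (real k * \<alpha> + 1) * V"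
        using \<alpha> by (simp add: V_def)
      also have "\<dots> \<le> (real k + 1) * V"
        using \<alpha> V by (intro mult_right_mono) (auto simp: mult_left_le)
      finally show "norm (iterate k \<omega> - z) \<le> norm (deviation z k \<omega>) + (real k + 1) * V"
        by simp
    qed (auto intro!: integrable_deviation)
    also have "\<dots> = expectation (\<lambda>\<omega>. norm (deviation z k \<omega>)) + (real k + 1) * V"
      by (simp add: integrable_deviation prob_space)
    also have "\<dots> \<le> b + (real k + 1) * V"
      using dev by simp
    also have "\<dots> \<le> (real k + 1) * (1 + V) + d"
      using mult_left_le_one_le[of "real k" c] c by (simp add: b_def distrib_left)
    finally have "6 * \<epsilon> * expectation (\<lambda>\<omega>. norm (iterate k \<omega> - z))
        \<le> 6 * \<epsilon> * ((real k + 1) * (1 + V) + d)"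
      using \<epsilon> by (intro mult_left_mono) auto
    also have "\<dots> = (real k + 1) * c\<^sup>2 + (6 * \<epsilon>) * d"
      by (simp add: \<epsilon>_c[symmetric] algebra_simps)
    also have "(6 * \<epsilon>) * d \<le> c * d"
      using \<epsilon>_le c2 d by (intro mult_right_mono) auto
    finally have "6 * \<epsilon> * expectation (\<lambda>\<omega>. norm (iterate k \<omega> - z)) \<le> (real k + 1) * c\<^sup>2 + c * d"
      by simp
    with second_moment_step[OF z, of k] Suc \<epsilon>2 d(2)
    have "expectation (\<lambda>\<omega>. (norm (deviation z (Suc k) \<omega>))\<^sup>2)
        \<le> (c * real k + d)\<^sup>2 + (real k + 1) * c\<^sup>2 + 2 * c * d"
      by (simp add: V_def)
    also have "\<dots> \<le> (c * real k + d)\<^sup>2 + (2 * real k + 1) * c\<^sup>2 + 2 * c * d"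
      by (simp add: mult_right_mono)
    also have "\<dots> = (c * real (Suc k) + d)\<^sup>2"
      by (simp add: power2_eq_square algebra_simps)
    finally show ?case .
  qed
  with z(1) show ?thesis by blast
qed

lemma integrable_normalized_error: "integrable M (\<lambda>\<omega>. (norm ((1 / real k) *\<^sub>R iterate k \<omega> + \<alpha> *\<^sub>R v))\<^sup>2)"
  by (rule integrable_iterate[of "\<lambda>y. (norm ((1 / real k) *\<^sub>R y + \<alpha> *\<^sub>R v))\<^sup>2"]) (intro continuous_intros)

text \<open>
  For positive \<open>k\<close> the normalized error is \<open>(r\<^sub>k + z - v) / k\<close>, with \<open>r\<^sub>k\<close> the deviation. The fixed
  vector \<open>z - v\<close> disappears in the limit, and the growth bound leaves \<open>2 c\<^sup>2\<close>.
\<close>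

lemma normalized_error_tendsto_0:
  "(\<lambda>k. expectation (\<lambda>\<omega>. (norm ((1 / real k) *\<^sub>R iterate k \<omega> + \<alpha> *\<^sub>R v))\<^sup>2)) \<longlonglongrightarrow> 0"
  (is "?E \<longlonglongrightarrow> 0")
proof (rule tendstoI)
  fix e :: real assume "0 < e"
  define c where "c = min 1 (sqrt e / 2)"
  have c: "0 < c" "c \<le> 1" using \<open>0 < e\<close> by (auto simp: c_def)
  have "c\<^sup>2 \<le> (sqrt e / 2)\<^sup>2" using c by (intro power_mono) (auto simp: c_def)
  then have ce: "2 * c\<^sup>2 < e" using \<open>0 < e\<close> by (simp add: power_divide)
  obtain z d where zd: "\<And>k. expectation (\<lambda>\<omega>. (norm (deviation z k \<omega>))\<^sup>2) \<le> (c * real k + d)\<^sup>2"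
    using second_moment_growth[OF c] by blast
  define N where "N = norm (z - v)"
  have bound: "?E k \<le> 2 * (c + d * (1 / real k))\<^sup>2 + 2 * (N * (1 / real k))\<^sup>2" if k: "0 < k" for k
  proof -
    have "?E k \<le> expectation (\<lambda>\<omega>. 2 * (1 / real k)\<^sup>2 * (norm (deviation z k \<omega>))\<^sup>2
        + 2 * (N * (1 / real k))\<^sup>2)"
    proof (intro integral_mono integrable_normalized_error)
      fix \<omega>
      let ?r = "deviation z k \<omega>"
      have "(1 / real k) *\<^sub>R iterate k \<omega> + \<alpha> *\<^sub>R v = (1 / real k) *\<^sub>R (?r + (z - v))"
        using k by (simp add: deviation_def algebra_simps)
      then have "(norm ((1 / real k) *\<^sub>R iterate k \<omega> + \<alpha> *\<^sub>R v))\<^sup>2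
          = (1 / real k)\<^sup>2 * (norm (?r + (z - v)))\<^sup>2"
        by (simp add: power_mult_distrib power_divide)
      also have "\<dots> \<le> (1 / real k)\<^sup>2 * (2 * (norm ?r)\<^sup>2 + 2 * N\<^sup>2)"
      proof (rule mult_left_mono)
        have "(norm (?r + (z - v)))\<^sup>2 \<le> (norm ?r + N)\<^sup>2"
          unfolding N_def by (intro power_mono norm_triangle_ineq) auto
        also have "\<dots> \<le> 2 * (norm ?r)\<^sup>2 + 2 * N\<^sup>2"
          using sum_squares_bound[of "norm ?r" N] by (simp add: power2_sum)
        finally show "(norm (?r + (z - v)))\<^sup>2 \<le> 2 * (norm ?r)\<^sup>2 + 2 * N\<^sup>2" .
      qed simp
      finally show "(norm ((1 / real k) *\<^sub>R iterate k \<omega> + \<alpha> *\<^sub>R v))\<^sup>2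
          \<le> 2 * (1 / real k)\<^sup>2 * (norm ?r)\<^sup>2 + 2 * (N * (1 / real k))\<^sup>2"
        by (simp only: power_mult_distrib distrib_left mult_ac)
    qed (auto intro!: integrable_deviation)
    also have "\<dots> = 2 * (1 / real k)\<^sup>2 * expectation (\<lambda>\<omega>. (norm (deviation z k \<omega>))\<^sup>2)
        + 2 * (N * (1 / real k))\<^sup>2"
      by (simp add: integrable_deviation prob_space)
    also have "\<dots> \<le> 2 * (1 / real k)\<^sup>2 * (c * real k + d)\<^sup>2 + 2 * (N * (1 / real k))\<^sup>2"
      by (intro add_right_mono mult_left_mono zd) auto
    also have "2 * (1 / real k)\<^sup>2 * (c * real k + d)\<^sup>2 = 2 * ((1 / real k) * (c * real k + d))\<^sup>2"
      by (simp only: power_mult_distrib mult.assoc)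
    also have "(1 / real k) * (c * real k + d) = c + d * (1 / real k)"
      using k by (simp add: field_simps)
    finally show ?thesis .
  qed
  have "(\<lambda>k. 2 * (c + d * (1 / real k))\<^sup>2 + 2 * (N * (1 / real k))\<^sup>2)
      \<longlonglongrightarrow> 2 * (c + d * 0)\<^sup>2 + 2 * (N * 0)\<^sup>2"
    by (intro tendsto_intros lim_1_over_n)
  then have "\<forall>\<^sub>F k in sequentially. 2 * (c + d * (1 / real k))\<^sup>2 + 2 * (N * (1 / real k))\<^sup>2 < e"
    by (rule order_tendstoD) (use ce in simp)
  then show "\<forall>\<^sub>F k in sequentially. dist (?E k) 0 < e"
    using eventually_gt_at_top[of 0]
  proof eventually_elim
    case (elim k)
    have "0 \<le> ?E k" by (rule integral_nonneg_AE) simp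
    with bound[OF elim(2)] elim(1) show ?case by simp
  qed
qed

end

theorem theorem4p3:
  fixes H :: "'m::finite \<Rightarrow> 'b::real_inner set"
    and T :: "'b^'m \<Rightarrow> 'b^'m"
    and \<theta> \<alpha> :: real
    and M :: "'w measure"
    and I :: "nat \<Rightarrow> 'w \<Rightarrow> real^'m"
    and x0 :: "'b^'m"
    and x :: "nat \<Rightarrow> 'w \<Rightarrow> 'b^'m"
    and v :: "'b^'m"
  assumes "\<And>i. hilbert_subspace (H i)"
    and "0 < \<theta>" and "\<theta> \<le> 1"
    and "T \<in> direct_sum H \<rightarrow> direct_sum H"
    and "averaged_on \<theta> (direct_sum H) T"
    and "prob_space M"
    and "prob_space.indep_vars M (\<lambda>_. borel) I UNIV"
    and "\<And>k. distr M borel (I k) = distr M borel (I 0)"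
    and "\<And>k \<omega> i. \<omega> \<in> space M \<Longrightarrow> I k \<omega> $ i \<in> {0..1}"
    and "0 < \<alpha>" and "\<alpha> \<le> 1"
    and "prob_space.expectation M (I 0) = \<alpha> *\<^sub>R 1"
    and "x0 \<in> direct_sum H"
    and "\<And>\<omega>. \<omega> \<in> space M \<Longrightarrow> x 0 \<omega> = x0"
    and "\<And>k \<omega>. \<omega> \<in> space M \<Longrightarrow> x (Suc k) \<omega> = T_sel \<theta> T (I k \<omega>) (x k \<omega>)"
    and "v = infimal_displacement (direct_sum H) T"
  shows "(\<forall>k. integrable M (\<lambda>\<omega>. (norm ((1 / real k) *\<^sub>R x k \<omega> + \<alpha> *\<^sub>R v))\<^sup>2)) \<and>
    (\<lambda>k. prob_space.expectation M (\<lambda>\<omega>. (norm ((1 / real k) *\<^sub>R x k \<omega> + \<alpha> *\<^sub>R v))\<^sup>2))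
      \<longlonglongrightarrow> 0"
proof -
  have H: "\<And>i. subspace (H i)" "\<And>i. complete (H i)"
    using assms(1) by (auto simp: hilbert_subspace_def)
  note X = subspace_direct_sum[OF H(1)] complete_direct_sum[OF H(2)]
  have lip: "1-lipschitz_on (direct_sum H) T"
    using assms(5,2,3) by (rule averaged_imp_nonexpansive)
  interpret prob_space M by fact
  interpret random_block_iteration M I \<alpha> H T x0 v
  proof
    show "v \<in> closure ((\<lambda>y. y - T y) ` direct_sum H)"
      using infimal_displacement_variational(1)[OF X assms(4) lip] assms(16) by simp
    show "0 \<le> v \<bullet> ((y - T y) - v)" if "y \<in> direct_sum H" for y
      using infimal_displacement_variational(2)[OF X assms(4) lip that] assms(16) by simp
  qed (use assms H lip in auto)
  have x: "x k \<omega> = iterate k \<omega>" if "\<omega> \<in> space M" for k \<omega>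
    using that assms(2)
    by (induction k) (simp_all add: assms(14,15) iterate_def T_sel_eq_block_step)
  have "integrable M (\<lambda>\<omega>. (norm ((1 / real k) *\<^sub>R x k \<omega> + \<alpha> *\<^sub>R v))\<^sup>2)" for k
    using integrable_normalized_error[of k] by (simp add: x cong: Bochner_Integration.integrable_cong)
  moreover have "expectation (\<lambda>\<omega>. (norm ((1 / real k) *\<^sub>R x k \<omega> + \<alpha> *\<^sub>R v))\<^sup>2)
      = expectation (\<lambda>\<omega>. (norm ((1 / real k) *\<^sub>R iterate k \<omega> + \<alpha> *\<^sub>R v))\<^sup>2)" for k
    by (intro Bochner_Integration.integral_cong) (simp_all add: x)
  ultimately show ?thesis
    using normalized_error_tendsto_0 by simp
qed

end
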